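(* Let $m\ge1$ and $0\le t\le m$ be integers, and let $f^{\pm}(x,t,m)=\sum_{n=0}^{2m-1}a^{\pm}(n,t,m)x^n$. Then, as rational functions of $x$, \[f^+(x,t,m)=\frac{1-x^m}{1-x}\left(\frac{x(1-x^{m-t})}{1-x}-\frac{x^{m-t+1}(1-x^{t-1})}{1-x}+(t-1)x^m+t\right),\] and \[f^-(x,t,m)=\frac{1-x^m}{1-x}\left(\frac{x^{t+1}(1-x^{m-t})}{1-x}-\frac{x(1-x^{t})}{1-x}+tx^m+t\right).\]
   Context: For a positive integer $m$ let $\varphi_m(u)=\min_{n\in\mathbb{Z}}|u-2nm|$ for $u\in\mathbb{Z}$ (so $\varphi_m$ is $2m$-periodic, even, and $\varphi_m(u)=u$ for $0\le u\le m$). The positive and negative circular sequences with first term $t$ and height $m$ are $a^+(n,t,m)=\varphi_m(t+n)$ and $a^-(n,t,m)=\varphi_m(t-n)$, $n\ge0$. *)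

theory Defs
  imports "HOL-Computational_Algebra.Polynomial_Factorial"
begin

definition circ_phi :: "nat \<Rightarrow> int \<Rightarrow> int" where
  "circ_phi m u = (LEAST d. d \<in> range (\<lambda>n::int. \<bar>u - 2 * n * int m\<bar>))"

definition circ_seq_pos :: "nat \<Rightarrow> nat \<Rightarrow> nat \<Rightarrow> int" where
  "circ_seq_pos n t m = circ_phi m (int t + int n)"

definition circ_seq_neg :: "nat \<Rightarrow> nat \<Rightarrow> nat \<Rightarrow> int" where
  "circ_seq_neg n t m = circ_phi m (int t - int n)"

definition circ_gf_pos :: "'a::comm_ring_1 \<Rightarrow> nat \<Rightarrow> nat \<Rightarrow> 'a" where
  "circ_gf_pos x t m = (\<Sum>n = 0..2 * m - 1. of_int (circ_seq_pos n t m) * x ^ n)"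

definition circ_gf_neg :: "'a::comm_ring_1 \<Rightarrow> nat \<Rightarrow> nat \<Rightarrow> 'a" where
  "circ_gf_neg x t m = (\<Sum>n = 0..2 * m - 1. of_int (circ_seq_neg n t m) * x ^ n)"

text \<open>The field of rational functions over \<open>'k\<close> is \<open>'k poly fract\<close>; this is its indeterminate.\<close>

definition indet :: "'k::field poly fract" where
  "indet = to_fract [:0, 1:]"

text \<open>The set in the definition of \<^const>\<open>circ_phi\<close> is infinite, so \<^const>\<open>Min\<close> would not be
  meaningful there; these lemmas show that the \<open>LEAST\<close> is a genuine minimum.\<close>

lemma circ_phi_least:
  "circ_phi m u \<in> range (\<lambda>n::int. \<bar>u - 2 * n * int m\<bar>) \<and>
    (\<forall>n::int. circ_phi m u \<le> \<bar>u - 2 * n * int m\<bar>)"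
proof -
  define f where "f = (\<lambda>n::int. \<bar>u - 2 * n * int m\<bar>)"
  obtain k where k: "\<And>n. nat (f k) \<le> nat (f n)"
    using ex_has_least_nat[of "\<lambda>_. True" 0 "\<lambda>n. nat (f n)"] by auto
  have min: "f k \<le> f n" for n
    using k[of n] by (simp add: f_def)
  have "circ_phi m u = f k"
    unfolding circ_phi_def f_def[symmetric]
    by (rule Least_equality) (use min in auto)
  then show ?thesis
    using min unfolding f_def by auto
qed

lemma circ_phi_eq:
  assumes "0 \<le> u" "u \<le> int m"
  shows "circ_phi m u = u"
proof -
  have "u \<le> \<bar>u - 2 * n * int m\<bar>" for n :: int
  proof (cases "n \<le> 0")
    case True
    then have "2 * n * int m \<le> 0" by (simp add: mult_nonpos_nonneg)
    then show ?thesis by linarith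
  next
    case False
    then have "1 * int m \<le> n * int m" by (intro mult_right_mono) auto
    then show ?thesis using assms by linarith
  qed
  moreover have "u \<in> range (\<lambda>n::int. \<bar>u - 2 * n * int m\<bar>)"
    by (rule range_eqI[of _ _ 0]) (use assms in simp)
  ultimately show ?thesis
    unfolding circ_phi_def by (intro Least_equality) auto
qed

end

theory Submission
  imports Defs
begin

text \<open>Both sequences satisfy \<open>a (n + m) = m - a n\<close>, so with \<open>A = (\<Sum>n<m. a n * x ^ n)\<close> the
  sum over a period is \<open>(1 - x ^ m) * A + m * x ^ m * (1 - x ^ m) / (1 - x)\<close>. Within the first
  \<open>m\<close> terms each sequence is linear with slope \<open>\<plusminus>1\<close> on two consecutive blocks, so \<open>A\<close> is a sum of
  two arithmetic-geometric sums.\<close>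

lemma circ_phi_eqI:
  assumes "\<And>d. d \<in> range (\<lambda>n::int. \<bar>u - 2 * n * int m\<bar>) \<longleftrightarrow> d \<in> range (\<lambda>n::int. \<bar>v - 2 * n * int m\<bar>)"
  shows "circ_phi m u = circ_phi m v"
  using assms unfolding circ_phi_def by presburger

lemma circ_phi_minus: "circ_phi m (- u) = circ_phi m u"
proof (rule circ_phi_eqI)
  have "\<bar>- v - 2 * n * int m\<bar> = \<bar>v - 2 * (- n) * int m\<bar>" for v n
    by (simp add: algebra_simps)
  then have sub: "range (\<lambda>n::int. \<bar>- v - 2 * n * int m\<bar>) \<subseteq> range (\<lambda>n::int. \<bar>v - 2 * n * int m\<bar>)" for v
    by blast
  show "d \<in> range (\<lambda>n::int. \<bar>- u - 2 * n * int m\<bar>) \<longleftrightarrow> d \<in> range (\<lambda>n::int. \<bar>u - 2 * n * int m\<bar>)" for d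
    using sub[of u] sub[of "- u"] unfolding minus_minus by blast
qed

lemma circ_phi_add_period: "circ_phi m (u + 2 * int m) = circ_phi m u"
proof (rule circ_phi_eqI)
  have "\<bar>u + 2 * int m - 2 * n * int m\<bar> = \<bar>u - 2 * (n - 1) * int m\<bar>"
    and "\<bar>u - 2 * n * int m\<bar> = \<bar>u + 2 * int m - 2 * (n + 1) * int m\<bar>" for n
    by (simp_all add: algebra_simps)
  then show "d \<in> range (\<lambda>n::int. \<bar>u + 2 * int m - 2 * n * int m\<bar>)
      \<longleftrightarrow> d \<in> range (\<lambda>n::int. \<bar>u - 2 * n * int m\<bar>)" for d
    by blast
qed

lemma circ_phi_eq_abs:
  assumes "\<bar>u\<bar> \<le> int m"
  shows "circ_phi m u = \<bar>u\<bar>"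
  using assms circ_phi_eq[of "\<bar>u\<bar>" m] circ_phi_minus[of m u] by (cases "0 \<le> u") auto

text \<open>Subtracting one period moves \<open>u\<close> into the window from
  \<open>- int m\<close> to \<open>int m\<close>, where \<open>circ_phi_eq_abs\<close> applies. The
  two lemmas together reach every argument up to \<open>3 * int m\<close>, hence all
  \<open>t + n\<close> with \<open>n < 2 * m\<close>.\<close>

lemma circ_phi_eq_reflect:
  assumes "int m \<le> u" "u \<le> 3 * int m"
  shows "circ_phi m u = \<bar>u - 2 * int m\<bar>"
  using assms circ_phi_eq_abs[of "u - 2 * int m" m] circ_phi_add_period[of m "u - 2 * int m"]
  by simp

lemma sum_lessThan_add:
  fixes f :: "nat \<Rightarrow> 'a::comm_monoid_add"
  shows "(\<Sum>n<a + b. f n) = (\<Sum>n<a. f n) + (\<Sum>n<b. f (a + n))"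
  by (induction b) (simp_all add: add.assoc)

text \<open>Multiplying by \<open>1 - x\<close> replaces coefficients by their successive
  differences, all equal to \<open>d\<close> except at the two ends; the last term is
  \<open>d\<close> times \<open>x + ... + x ^ k\<close>.\<close>

lemma sum_arith_geometric:
  fixes x :: "'a::field"
  assumes "x \<noteq> 1"
  shows "(1 - x) * (\<Sum>n<k. (c + d * of_nat n) * x ^ n) =
    c - (c + d * of_nat k) * x ^ k + d * (x * (1 - x ^ k) / (1 - x))"
proof (induction k)
  case (Suc k)
  have nz: "1 - x \<noteq> 0"
    using assms by simp
  have "x * (1 - x ^ Suc k) / (1 - x) = x * (1 - x ^ k) / (1 - x) + x * x ^ k"
    using nz by (simp add: divide_simps) (simp add: algebra_simps)
  then show ?case
    unfolding sum.lessThan_Suc distrib_left[of "1 - x"] Suc.IH by (simp add: algebra_simps)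
qed simp

text \<open>The factor \<open>1 - x\<close> stays attached to the half-period sum so that
  \<open>sum_arith_geometric\<close> can evaluate it block by block.\<close>

lemma sum_antiperiodic:
  fixes x :: "'a::field"
  assumes "x \<noteq> 1" and anti: "\<And>n. n < m \<Longrightarrow> a (m + n) = int m - a n"
  shows "(\<Sum>n<m + m. of_int (a n) * x ^ n) =
    (1 - x ^ m) / (1 - x) * ((1 - x) * (\<Sum>n<m. of_int (a n) * x ^ n) + of_nat m * x ^ m)"
proof -
  have nz: "1 - x \<noteq> 0"
    using assms by simp
  have geo: "(\<Sum>n<m. x ^ n) = (1 - x ^ m) / (1 - x)"
    by (simp add: geometric_sum \<open>x \<noteq> 1\<close>) (metis minus_diff_eq minus_divide_divide)
  have "(\<Sum>n<m. of_int (a (m + n)) * x ^ (m + n)) =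
      (\<Sum>n<m. of_nat m * x ^ m * x ^ n - x ^ m * (of_int (a n) * x ^ n))"
    by (intro sum.cong refl) (simp add: anti power_add left_diff_distrib right_diff_distrib mult_ac)
  also have "\<dots> = of_nat m * x ^ m * ((1 - x ^ m) / (1 - x)) - x ^ m * (\<Sum>n<m. of_int (a n) * x ^ n)"
    by (simp add: sum_subtractf sum_distrib_left[symmetric] geo)
  finally show ?thesis
    unfolding sum_lessThan_add using nz by (simp add: divide_simps) (simp add: algebra_simps)
qed

text \<open>The sequence climbs from \<open>t\<close> to \<open>m\<close>, descends to 0, and climbs
  again. The assumption \<open>x \<noteq> 0\<close> gives meaning to
  \<open>x powi (int t - 1)\<close> at \<open>t = 0\<close>, where the exponent is -1.\<close>

lemma circ_gf_pos_closed:
  fixes x :: "'a::field"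
  assumes "1 \<le> m" "t \<le> m" "x \<noteq> 1" "x \<noteq> 0"
  shows "circ_gf_pos x t m =
    (1 - x ^ m) / (1 - x) *
      (x * (1 - x ^ (m - t)) / (1 - x)
        - x ^ (m - t + 1) * (1 - x powi (int t - 1)) / (1 - x)
        + (of_nat t - 1) * x ^ m + of_nat t)"
proof -
  have nz: "1 - x \<noteq> 0"
    using assms by simp
  \<comment> \<open>The index of the peak, where \<open>t + s = m\<close>.\<close>
  define s where "s = m - t"
  have m: "m = s + t"
    using assms by (simp add: s_def)
  have low: "circ_seq_pos n t m = int t + int n" if "n \<le> s" for n
    using that unfolding circ_seq_pos_def by (subst circ_phi_eq_abs) (auto simp: m)
  have high: "circ_seq_pos (s + n) t m = int m - int n" if "n \<le> m" for n
    using that unfolding circ_seq_pos_def by (subst circ_phi_eq_reflect) (auto simp: m)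
  have tail: "circ_seq_pos (s + m + n) t m = int n" if "n \<le> m" for n
    using that unfolding circ_seq_pos_def by (subst circ_phi_eq_reflect) (auto simp: m)
  \<comment> \<open>A shift by \<open>m\<close> carries the first climb into the descent, and the
    part of the descent after the peak into the second climb.\<close>
  have anti: "circ_seq_pos (m + n) t m = int m - circ_seq_pos n t m" if "n < m" for n
  proof (cases "n \<le> s")
    case True
    then show ?thesis
      using low[of n] high[of "t + n"] by (simp add: m add_ac)
  next
    case False
    then show ?thesis
      using that high[of "n - s"] tail[of "n - s"] by (simp add: add.commute)
  qed
  have A: "(\<Sum>n<m. of_int (circ_seq_pos n t m) * x ^ n) =
      (\<Sum>n<s. (of_nat t + 1 * of_nat n) * x ^ n)
        + x ^ s * (\<Sum>n<t. (of_nat m + (- 1) * of_nat n) * x ^ n)"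
  proof -
    have "(\<Sum>n<m. of_int (circ_seq_pos n t m) * x ^ n) =
        (\<Sum>n<s. of_int (circ_seq_pos n t m) * x ^ n)
          + (\<Sum>n<t. of_int (circ_seq_pos (s + n) t m) * x ^ (s + n))"
      using sum_lessThan_add[of _ s t] by (simp only: m[symmetric])
    also have "(\<Sum>n<s. of_int (circ_seq_pos n t m) * x ^ n) =
        (\<Sum>n<s. (of_nat t + 1 * of_nat n) * x ^ n)"
      by (intro sum.cong refl) (simp add: low)
    also have "(\<Sum>n<t. of_int (circ_seq_pos (s + n) t m) * x ^ (s + n)) =
        x ^ s * (\<Sum>n<t. (of_nat m + (- 1) * of_nat n) * x ^ n)"
      unfolding sum_distrib_left
      by (intro sum.cong refl) (use assms in \<open>simp add: high power_add left_diff_distrib mult_ac\<close>)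
    finally show ?thesis .
  qed
  \<comment> \<open>Trades the exponent \<open>t - 1\<close> for the \<open>t\<close> that
    \<open>sum_arith_geometric\<close> produces. The cost \<open>x ^ m\<close> explains the
    coefficient \<open>t - 1\<close> in the formula.\<close>
  have pw: "x ^ (s + 1) * (1 - x powi (int t - 1)) / (1 - x) =
      x ^ s * (x * (1 - x ^ t) / (1 - x)) - x ^ m"
  proof -
    have "x ^ (s + 1) * (1 - x powi (int t - 1)) = x ^ s * (x - x ^ t)"
      using \<open>x \<noteq> 0\<close> by (simp add: power_int_diff algebra_simps)
    then show ?thesis
      using nz by (simp add: m divide_simps) (simp add: power_add algebra_simps)
  qed
  \<comment> \<open>Subtraction on naturals truncates, so \<open>1 \<le> m\<close> is what makes the
    range up to \<open>2 * m - 1\<close> have \<open>2 * m\<close> indices.\<close>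
  have gf: "circ_gf_pos x t m = (\<Sum>n<m + m. of_int (circ_seq_pos n t m) * x ^ n)"
    unfolding circ_gf_pos_def using \<open>1 \<le> m\<close> by (intro sum.cong) auto
  \<comment> \<open>The terms \<open>m * x ^ s\<close> of the two blocks cancel at the peak; the
    other end terms and \<open>m * x ^ m\<close> leave \<open>t + t * x ^ m\<close>.\<close>
  have "(1 - x) * (\<Sum>n<m. of_int (circ_seq_pos n t m) * x ^ n) + of_nat m * x ^ m =
      x * (1 - x ^ s) / (1 - x) - x ^ (s + 1) * (1 - x powi (int t - 1)) / (1 - x)
        + (of_nat t - 1) * x ^ m + of_nat t"
    unfolding A distrib_left mult.left_commute[of "1 - x" "x ^ s"]
      sum_arith_geometric[OF \<open>x \<noteq> 1\<close>] pw
    by (simp add: m power_add algebra_simps diff_divide_distrib)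
  then show ?thesis
    unfolding gf
    by (subst sum_antiperiodic[OF \<open>x \<noteq> 1\<close>]) (simp_all only: s_def anti)
qed

text \<open>Here the descent comes first: from \<open>t\<close> to 0 at index \<open>t\<close>, then
  up to \<open>m\<close> at index \<open>t + m\<close>, then down again.\<close>

lemma circ_gf_neg_closed:
  fixes x :: "'a::field"
  assumes "1 \<le> m" "t \<le> m" "x \<noteq> 1"
  shows "circ_gf_neg x t m =
    (1 - x ^ m) / (1 - x) *
      (x ^ (t + 1) * (1 - x ^ (m - t)) / (1 - x)
        - x * (1 - x ^ t) / (1 - x)
        + of_nat t * x ^ m + of_nat t)"
proof -
  define s where "s = m - t"
  have m: "m = t + s"
    using assms by (simp add: s_def)
  have mid: "circ_seq_neg n t m = \<bar>int t - int n\<bar>" if "n \<le> t + m" for n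
    using that unfolding circ_seq_neg_def by (subst circ_phi_eq_abs) (auto simp: m)
  \<comment> \<open>The argument is \<open>- (m + n)\<close>; evenness makes it positive before
    reflecting.\<close>
  have tail: "circ_seq_neg (t + m + n) t m = int m - int n" if "n \<le> m" for n
    using that circ_phi_minus[of m "int t - int (t + m + n)"] unfolding circ_seq_neg_def
    by (simp add: circ_phi_eq_reflect)
  have anti: "circ_seq_neg (m + n) t m = int m - circ_seq_neg n t m" if "n < m" for n
  proof (cases "n \<le> t")
    case True
    then show ?thesis
      using mid[of n] mid[of "m + n"] by (simp add: m)
  next
    case False
    then show ?thesis
      using that mid[of n] tail[of "n - t"] by (simp add: add.commute)
  qed
  have A: "(\<Sum>n<m. of_int (circ_seq_neg n t m) * x ^ n) =
      (\<Sum>n<t. (of_nat t + (- 1) * of_nat n) * x ^ n)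
        + x ^ t * (\<Sum>n<s. (0 + 1 * of_nat n) * x ^ n)"
  proof -
    have "(\<Sum>n<m. of_int (circ_seq_neg n t m) * x ^ n) =
        (\<Sum>n<t. of_int (circ_seq_neg n t m) * x ^ n)
          + (\<Sum>n<s. of_int (circ_seq_neg (t + n) t m) * x ^ (t + n))"
      using sum_lessThan_add[of _ t s] by (simp only: m[symmetric])
    also have "(\<Sum>n<t. of_int (circ_seq_neg n t m) * x ^ n) =
        (\<Sum>n<t. (of_nat t + (- 1) * of_nat n) * x ^ n)"
      by (intro sum.cong refl) (simp add: mid)
    also have "(\<Sum>n<s. of_int (circ_seq_neg (t + n) t m) * x ^ (t + n)) =
        x ^ t * (\<Sum>n<s. (0 + 1 * of_nat n) * x ^ n)"
      unfolding sum_distrib_left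
      by (intro sum.cong refl) (simp add: mid s_def power_add mult_ac)
    finally show ?thesis .
  qed
  have gf: "circ_gf_neg x t m = (\<Sum>n<m + m. of_int (circ_seq_neg n t m) * x ^ n)"
    unfolding circ_gf_neg_def using \<open>1 \<le> m\<close> by (intro sum.cong) auto
  \<comment> \<open>Both blocks meet at the value 0, so nothing arises at the junction;
    \<open>- s * x ^ m\<close> and \<open>m * x ^ m\<close> combine to
    \<open>t * x ^ m\<close>.\<close>
  have "(1 - x) * (\<Sum>n<m. of_int (circ_seq_neg n t m) * x ^ n) + of_nat m * x ^ m =
      x ^ (t + 1) * (1 - x ^ s) / (1 - x) - x * (1 - x ^ t) / (1 - x)
        + of_nat t * x ^ m + of_nat t"
    unfolding A distrib_left mult.left_commute[of "1 - x" "x ^ t"]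
      sum_arith_geometric[OF \<open>x \<noteq> 1\<close>]
    by (simp add: m power_add algebra_simps diff_divide_distrib)
  then show ?thesis
    unfolding gf
    by (subst sum_antiperiodic[OF \<open>x \<noteq> 1\<close>]) (simp_all only: s_def anti)
qed

text \<open>The closed forms hold at field elements other than 0 and 1. For the indeterminate both
  exclusions reduce to comparing polynomials, as the denominators are 1.\<close>

lemma indet_neq_0: "indet \<noteq> 0"
  unfolding indet_def by (simp add: to_fract_def Zero_fract_def eq_fract)

lemma indet_neq_1: "indet \<noteq> 1"
  unfolding indet_def by (simp add: to_fract_def One_fract_def eq_fract one_pCons)

theorem theorem5p6:
  fixes m t :: nat and x :: "'k::field_char_0 poly fract"
  defines "x \<equiv> indet"
  assumes "1 \<le> m" and "t \<le> m"
  shows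
    "circ_gf_pos x t m =
      (1 - x ^ m) / (1 - x) *
        (x * (1 - x ^ (m - t)) / (1 - x)
          - x ^ (m - t + 1) * (1 - x powi (int t - 1)) / (1 - x)
          + (of_nat t - 1) * x ^ m + of_nat t)
     \<and> circ_gf_neg x t m =
      (1 - x ^ m) / (1 - x) *
        (x ^ (t + 1) * (1 - x ^ (m - t)) / (1 - x)
          - x * (1 - x ^ t) / (1 - x)
          + of_nat t * x ^ m + of_nat t)"
  unfolding x_def
  using circ_gf_pos_closed[OF assms(2,3) indet_neq_1 indet_neq_0]
    circ_gf_neg_closed[OF assms(2,3) indet_neq_1]
  by blast

end
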